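(* Fix a parity for virtual knots, and for a virtual knot diagram $K$ let $f(K)$ be the diagram obtained from $K$ by making all odd classical crossings virtual (equivalently, by removing all odd chords from the Gauss diagram of $K$). Then $f$ is a well-defined map on the set of all virtual knots: if two virtual knot diagrams $K$ and $K'$ represent the same virtual knot, then $f(K)$ and $f(K')$ represent the same virtual knot. Moreover, for a virtual knot diagram $K$ one has $f(K)=K$ if and only if all classical crossings of $K$ are even; otherwise the number of classical crossings of $f(K)$ is strictly less than the number of classical crossings of $K$.
   Context: A virtual diagram is a generic immersion in $\mathbb{R}^2$ of a 4-valent graph (components homeomorphic to a circle without vertices are allowed) in which each image of a vertex carries a classical over/under crossing structure and each transverse intersection of interiors of edges is marked as a virtual crossing. A virtual link is an equivalence class of virtual diagrams modulo the usual Reidemeister moves $\Omega_1,\Omega_2,\Omega_3$ applied to classical crossings and the detour move (an edge fragment containing only virtual crossings and virtual self-crossings is redrawn arbitrarily and generically, all new crossings being virtual). A virtual knot is a one-component virtual link. Diagrams are considered up to detour moves; equivalently, a virtual knot diagram is encoded by its Gauss diagram: an oriented circle with one chord per classical crossing joining its two preimages, each chord carrying the sign of the crossing and an arrow from the overpass to the underpass. A parity for virtual knots is a rule declaring every classical crossing of every virtual knot diagram (depending only on the diagram up to detour moves, i.e. on the Gauss diagram up to isomorphism) to be even or odd, such that: (1) the crossing added or removed by a first Reidemeister move is even; (2) the two crossings added or removed by a second Reidemeister move have the same parity; (3) among the three crossings participating in a third Reidemeister move the number of odd ones is even, and the parity of each of these three crossings is the same before and after the move (under the natural correspondence of crossings);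 (4) crossings not participating in a Reidemeister move do not change their parity under the move. An example is the Gaussian parity: a crossing is even if its chord is linked with an even number of other chords of the Gauss diagram, and odd otherwise, where two chords are linked if the ends of one lie in different components of the circle minus the ends of the other. *)

theory Defs
  imports Main
begin

text \<open>
  Virtual knot diagrams (up to detour moves) are represented by their Gauss diagrams, and a Gauss
  diagram by the cyclic word of chord ends met when travelling once around the oriented circle.
  \<open>Over c s\<close> is the tail (on the overpass) and \<open>Under c s\<close> the head (on the underpass) of the chord
  with label \<open>c\<close> and sign \<open>s\<close>, a sign being \<open>1\<close> or \<open>-1\<close>.  The base point and the labels are
  immaterial: see \<open>gauss_iso\<close>.
\<close>

datatype 'c chord_end = Over (chord: 'c) (sign: int) | Under (chord: 'c) (sign: int)

type_synonym gauss_word = "nat chord_end list"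

definition crossings :: "gauss_word \<Rightarrow> nat set" where
  "crossings K = chord ` set K"

definition gauss_diagram :: "gauss_word \<Rightarrow> bool" where
  "gauss_diagram K \<longleftrightarrow> distinct K \<and>
     (\<forall>c \<in> crossings K. \<exists>s \<in> {1, -1}. {e \<in> set K. chord e = c} = {Over c s, Under c s})"

definition gauss_iso :: "(nat \<Rightarrow> nat) \<Rightarrow> gauss_word \<Rightarrow> gauss_word \<Rightarrow> bool" where
  "gauss_iso \<phi> K K' \<longleftrightarrow> gauss_diagram K \<and> gauss_diagram K' \<and> inj_on \<phi> (crossings K) \<and>
     (\<exists>n. K' = rotate n (map (map_chord_end \<phi>) K))"

definition gauss_isomorphic :: "gauss_word \<Rightarrow> gauss_word \<Rightarrow> bool" where
  "gauss_isomorphic K K' \<longleftrightarrow> (\<exists>\<phi>. gauss_iso \<phi> K K')"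

text \<open>
  The Reidemeister moves on Gauss diagrams, with the base point placed conveniently; composing with
  rotations (instances of \<open>gauss_iso\<close>) gives them in every position.  The first arguments are the
  participating crossings; every crossing present on both sides keeps its label, so the natural
  correspondence of crossings is the identity on labels.  The first two moves are oriented so as
  to add crossings.
\<close>

inductive omega1 :: "nat \<Rightarrow> gauss_word \<Rightarrow> gauss_word \<Rightarrow> bool" where
  over_under: "gauss_diagram K \<Longrightarrow> gauss_diagram ([Over a s, Under a s] @ K) \<Longrightarrow>
     omega1 a K ([Over a s, Under a s] @ K)"
| under_over: "gauss_diagram K \<Longrightarrow> gauss_diagram ([Under a s, Over a s] @ K) \<Longrightarrow>
     omega1 a K ([Under a s, Over a s] @ K)"

text \<open>The two rules are the cases of parallel and of antiparallel strands.\<close>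

inductive omega2 :: "nat \<Rightarrow> nat \<Rightarrow> gauss_word \<Rightarrow> gauss_word \<Rightarrow> bool" where
  parallel: "gauss_diagram (xs @ ys) \<Longrightarrow>
     K' = [Over a s, Over b (-s)] @ xs @ [Under a s, Under b (-s)] @ ys \<Longrightarrow>
     gauss_diagram K' \<Longrightarrow> omega2 a b (xs @ ys) K'"
| antiparallel: "gauss_diagram (xs @ ys) \<Longrightarrow>
     K' = [Over a s, Over b (-s)] @ xs @ [Under b (-s), Under a s] @ ys \<Longrightarrow>
     gauss_diagram K' \<Longrightarrow> omega2 a b (xs @ ys) K'"

definition in_order :: "int \<Rightarrow> 'a \<Rightarrow> 'a \<Rightarrow> 'a list" where
  "in_order \<epsilon> x y = (if \<epsilon> = 1 then [x, y] else [y, x])"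

text \<open>
  The fragments of the top, middle and bottom strand of a third Reidemeister move.  The crossing of
  top and middle is \<open>a\<close>, of top and bottom \<open>b\<close>, of middle and bottom \<open>c\<close>.  Let \<open>A\<close>, \<open>B\<close>, \<open>C\<close> be
  the corresponding vertices of the triangle, and let the strands be directed along
  \<open>\<alpha> (B - A)\<close>, \<open>\<beta> (C - A)\<close>, \<open>\<gamma> (C - B)\<close>.  The sign of a crossing is the sign of
  \<open>det (over direction, under direction)\<close>; with \<open>\<delta>\<close> the orientation of the triangle \<open>ABC\<close> the
  signs of \<open>a\<close>, \<open>b\<close>, \<open>c\<close> are therefore \<open>\<alpha>\<beta>\<delta>\<close>, \<open>\<alpha>\<gamma>\<delta>\<close>, \<open>\<beta>\<gamma>\<delta>\<close>.  The move reflects the triangle in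
  a point: all signs and \<open>\<delta>\<close> are kept and the order is reversed on every strand.  All choices of
  \<open>\<alpha>\<close>, \<open>\<beta>\<close>, \<open>\<gamma>\<close>, \<open>\<delta>\<close> together give all eight oriented third Reidemeister moves.
\<close>

definition omega3_strands ::
    "nat \<Rightarrow> nat \<Rightarrow> nat \<Rightarrow> gauss_word \<Rightarrow> gauss_word \<Rightarrow> gauss_word \<Rightarrow> bool" where
  "omega3_strands a b c t m u \<longleftrightarrow>
     (\<exists>\<alpha> \<in> {1, -1}. \<exists>\<beta> \<in> {1, -1}. \<exists>\<gamma> \<in> {1, -1}. \<exists>\<delta> \<in> {1, -1}.
        t = in_order \<alpha> (Over a (\<alpha> * \<beta> * \<delta>)) (Over b (\<alpha> * \<gamma> * \<delta>)) \<and>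
        m = in_order \<beta> (Under a (\<alpha> * \<beta> * \<delta>)) (Over c (\<beta> * \<gamma> * \<delta>)) \<and>
        u = in_order \<gamma> (Under b (\<alpha> * \<gamma> * \<delta>)) (Under c (\<beta> * \<gamma> * \<delta>)))"

text \<open>The two rules are the two cyclic orders in which the knot can run through the strands.\<close>

inductive omega3 :: "nat \<Rightarrow> nat \<Rightarrow> nat \<Rightarrow> gauss_word \<Rightarrow> gauss_word \<Rightarrow> bool" where
  top_middle_bottom: "omega3_strands a b c t m u \<Longrightarrow>
     K = t @ xs @ m @ ys @ u @ zs \<Longrightarrow>
     K' = rev t @ xs @ rev m @ ys @ rev u @ zs \<Longrightarrow>
     gauss_diagram K \<Longrightarrow> gauss_diagram K' \<Longrightarrow> omega3 a b c K K'"
| top_bottom_middle: "omega3_strands a b c t m u \<Longrightarrow>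
     K = t @ xs @ u @ ys @ m @ zs \<Longrightarrow>
     K' = rev t @ xs @ rev u @ ys @ rev m @ zs \<Longrightarrow>
     gauss_diagram K \<Longrightarrow> gauss_diagram K' \<Longrightarrow> omega3 a b c K K'"

definition elementary_move :: "gauss_word \<Rightarrow> gauss_word \<Rightarrow> bool" where
  "elementary_move K K' \<longleftrightarrow> gauss_isomorphic K K' \<or>
     (\<exists>a. omega1 a K K') \<or> (\<exists>a b. omega2 a b K K') \<or> (\<exists>a b c. omega3 a b c K K')"

definition same_virtual_knot :: "gauss_word \<Rightarrow> gauss_word \<Rightarrow> bool" where
  "same_virtual_knot K K' \<longleftrightarrow> gauss_diagram K \<and> gauss_diagram K' \<and> equivclp elementary_move K K'"

quotient_type virtual_knot = gauss_word / partial: same_virtual_knot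
proof (rule part_equivpI)
  show "\<exists>K. same_virtual_knot K K"
    by (rule exI[of _ "[]"]) (simp add: same_virtual_knot_def gauss_diagram_def crossings_def)
  show "symp same_virtual_knot"
    by (auto intro!: sympI simp: same_virtual_knot_def intro: equivclp_sym)
  show "transp same_virtual_knot"
    by (auto intro!: transpI simp: same_virtual_knot_def intro: equivclp_trans)
qed

abbreviation virtual_knot_of :: "gauss_word \<Rightarrow> virtual_knot" where
  "virtual_knot_of \<equiv> abs_virtual_knot"

text \<open>
  \<open>is_odd K c\<close>: the crossing \<open>c\<close> of \<open>K\<close> is odd.  Values at words that are not Gauss diagrams, or at
  labels that are not crossings of \<open>K\<close>, are irrelevant.
\<close>

locale knot_parity =
  fixes is_odd :: "gauss_word \<Rightarrow> nat \<Rightarrow> bool"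
  assumes iso_invariant: "gauss_iso \<phi> K K' \<Longrightarrow> c \<in> crossings K \<Longrightarrow> is_odd K' (\<phi> c) = is_odd K c"
    and omega1_even: "omega1 a K K' \<Longrightarrow> \<not> is_odd K' a"
    and omega2_same: "omega2 a b K K' \<Longrightarrow> is_odd K' a = is_odd K' b"
    and omega3_sum: "omega3 a b c K K' \<Longrightarrow> even (card {x \<in> {a, b, c}. is_odd K x})"
    and omega3_same: "omega3 a b c K K' \<Longrightarrow> x \<in> {a, b, c} \<Longrightarrow> is_odd K' x = is_odd K x"
    and omega1_others: "omega1 a K K' \<Longrightarrow> x \<in> crossings K \<Longrightarrow> is_odd K' x = is_odd K x"
    and omega2_others: "omega2 a b K K' \<Longrightarrow> x \<in> crossings K \<Longrightarrow> is_odd K' x = is_odd K x"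
    and omega3_others: "omega3 a b c K K' \<Longrightarrow> x \<in> crossings K - {a, b, c} \<Longrightarrow>
      is_odd K' x = is_odd K x"

definition remove_odd :: "(gauss_word \<Rightarrow> nat \<Rightarrow> bool) \<Rightarrow> gauss_word \<Rightarrow> gauss_word" where
  "remove_odd is_odd K = filter (\<lambda>e. \<not> is_odd K (chord e)) K"

end

theory Submission
  imports Defs
begin

text \<open>
  Removing the odd chords turns an isomorphism into an isomorphism and a first Reidemeister move
  into a first Reidemeister move.  A second move becomes a second move or an isomorphism, according
  as its two crossings are even or odd.  In a third move either no crossing is odd, and the move
  survives, or at least two are odd; then every strand keeps at most one crossing, so reversing the
  strands has no effect after the removal.
\<close>

section \<open>Deleting chords from Gauss diagrams\<close>

lemma crossings_filter: "crossings (filter (\<lambda>e. P (chord e)) K) = {c \<in> crossings K. P c}"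
  by (auto simp: crossings_def)

text \<open>The predicate sees only the label of an end, so the two ends of a chord are kept or
  deleted together.\<close>

lemma gauss_diagram_filter:
  assumes "gauss_diagram K"
  shows "gauss_diagram (filter (\<lambda>e. P (chord e)) K)"
  unfolding gauss_diagram_def
proof (intro conjI ballI)
  show "distinct (filter (\<lambda>e. P (chord e)) K)"
    using assms by (simp add: gauss_diagram_def)
  fix c assume "c \<in> crossings (filter (\<lambda>e. P (chord e)) K)"
  then have c: "c \<in> crossings K" "P c"
    by (auto simp: crossings_filter)
  have "{e \<in> set (filter (\<lambda>e. P (chord e)) K). chord e = c} = {e \<in> set K. chord e = c}"
    using c(2) by auto
  then show "\<exists>s\<in>{1, -1}. {e \<in> set (filter (\<lambda>e. P (chord e)) K). chord e = c} =
      {Over c s, Under c s}"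
    using assms c(1) by (simp add: gauss_diagram_def)
qed

text \<open>Rotating by one letter becomes a rotation by one letter if that letter survives the
  filter and no rotation otherwise. So \<open>m\<close> may differ from \<open>n\<close>, which is
  harmless since \<open>gauss_iso\<close> allows any rotation.\<close>

lemma filter_rotate: "\<exists>m. filter P (rotate n xs) = rotate m (filter P xs)"
proof (induction n)
  case 0
  then show ?case by (metis rotate0 id_apply)
next
  case (Suc n)
  then obtain m where m: "filter P (rotate n xs) = rotate m (filter P xs)" by blast
  have "\<exists>k. filter P (rotate1 ys) = rotate k (filter P ys)" for ys
  proof (cases ys)
    case Nil
    then show ?thesis by simp
  next
    case (Cons y zs)
    show ?thesis
    proof (cases "P y")
      case True
      then have "filter P (rotate1 ys) = rotate 1 (filter P ys)" using Cons by simp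
      then show ?thesis ..
    next
      case False
      then have "filter P (rotate1 ys) = rotate 0 (filter P ys)" using Cons by simp
      then show ?thesis ..
    qed
  qed
  then show ?case by (metis m rotate_Suc rotate_rotate)
qed

lemma gauss_isomorphic_refl: "gauss_diagram K \<Longrightarrow> gauss_isomorphic K K"
  unfolding gauss_isomorphic_def gauss_iso_def
  by (intro exI[of _ id] conjI exI[of _ 0]) (auto simp: chord_end.map_id0)

lemma gauss_isomorphic_length: "gauss_isomorphic K K' \<Longrightarrow> length K = length K'"
  by (auto simp: gauss_isomorphic_def gauss_iso_def)

lemma elementary_move_gauss_diagram:
  assumes "elementary_move K K'"
  shows "gauss_diagram K" "gauss_diagram K'"
  using assms
  by (auto simp: elementary_move_def gauss_isomorphic_def gauss_iso_def
      elim!: omega1.cases omega2.cases omega3.cases)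

text \<open>Lets both sides of a move be filtered by the parities of a single diagram, so that the
  two results can be compared as words.\<close>

lemma filter_even_cong:
  assumes "\<And>c. c \<in> crossings L \<Longrightarrow> is_odd K c = is_odd K' c"
  shows "filter (\<lambda>e. \<not> is_odd K (chord e)) L = filter (\<lambda>e. \<not> is_odd K' (chord e)) L"
  using assms by (intro filter_cong) (auto simp: crossings_def)

section \<open>Removal of odd chords and its fixed diagrams\<close>

lemma gauss_diagram_remove_odd: "gauss_diagram K \<Longrightarrow> gauss_diagram (remove_odd is_odd K)"
  unfolding remove_odd_def by (rule gauss_diagram_filter)

lemma crossings_remove_odd: "crossings (remove_odd is_odd K) = {c \<in> crossings K. \<not> is_odd K c}"
  unfolding remove_odd_def by (rule crossings_filter)

lemma remove_odd_eq_iff: "remove_odd is_odd K = K \<longleftrightarrow> (\<forall>c \<in> crossings K. \<not> is_odd K c)"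
  by (auto simp: remove_odd_def filter_id_conv crossings_def)

text \<open>An isomorphism preserves the length of the word, and a filter that preserves the length
  deletes nothing.\<close>

lemma gauss_isomorphic_remove_odd_iff:
  assumes "gauss_diagram K"
  shows "gauss_isomorphic (remove_odd is_odd K) K \<longleftrightarrow> (\<forall>c \<in> crossings K. \<not> is_odd K c)"
proof
  assume "gauss_isomorphic (remove_odd is_odd K) K"
  then have "length (remove_odd is_odd K) = length K"
    by (rule gauss_isomorphic_length)
  then have "\<forall>e \<in> set K. \<not> is_odd K (chord e)"
    unfolding remove_odd_def by (metis length_filter_less less_irrefl)
  then show "\<forall>c \<in> crossings K. \<not> is_odd K c"
    by (simp add: crossings_def)
next
  assume "\<forall>c \<in> crossings K. \<not> is_odd K c"
  then have "remove_odd is_odd K = K"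
    by (simp add: remove_odd_eq_iff)
  then show "gauss_isomorphic (remove_odd is_odd K) K"
    using gauss_isomorphic_refl[OF assms] by simp
qed

lemma card_crossings_remove_odd_less:
  assumes "c \<in> crossings K" "is_odd K c"
  shows "card (crossings (remove_odd is_odd K)) < card (crossings K)"
proof (rule psubset_card_mono)
  show "finite (crossings K)"
    by (simp add: crossings_def)
  show "crossings (remove_odd is_odd K) \<subset> crossings K"
    using assms by (auto simp: crossings_remove_odd)
qed

section \<open>Strands of a third move after deletion\<close>

lemma filter_in_order_both: "P x \<Longrightarrow> P y \<Longrightarrow> filter P (in_order \<epsilon> x y) = in_order \<epsilon> x y"
  by (simp add: in_order_def)

text \<open>At most one of the two letters survives, and a list of length at most one is its own
  reversal.\<close>

lemma rev_filter_in_order: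
  "\<not> P x \<or> \<not> P y \<Longrightarrow> rev (filter P (in_order \<epsilon> x y)) = filter P (in_order \<epsilon> x y)"
  by (auto simp: in_order_def)

lemma omega3_strands_filter_even:
  assumes "omega3_strands a b c t m u" "P a" "P b" "P c"
  defines "Q \<equiv> \<lambda>e. P (chord e)"
  shows "filter Q t = t" "filter Q m = m" "filter Q u = u"
  using assms by (auto simp: omega3_strands_def Q_def filter_in_order_both)

text \<open>Each strand avoids just one of the three crossings, so whichever two are deleted, every
  strand loses a letter.\<close>

lemma omega3_strands_rev_filter:
  assumes "omega3_strands a b c t m u" "\<not> P a \<and> \<not> P b \<or> \<not> P a \<and> \<not> P c \<or> \<not> P b \<and> \<not> P c"
  defines "Q \<equiv> \<lambda>e. P (chord e)"
  shows "rev (filter Q t) = filter Q t" "rev (filter Q m) = filter Q m"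
    "rev (filter Q u) = filter Q u"
proof -
  \<comment> \<open>The sign formulas are forgotten: what matters is only which crossings lie on
    which strand.\<close>
  obtain \<alpha> \<beta> \<gamma> s1 s2 s3 where
    "t = in_order \<alpha> (Over a s1) (Over b s2)"
    "m = in_order \<beta> (Under a s1) (Over c s3)"
    "u = in_order \<gamma> (Under b s2) (Under c s3)"
    using assms(1) unfolding omega3_strands_def by blast
  with assms(2) show "rev (filter Q t) = filter Q t" "rev (filter Q m) = filter Q m"
    "rev (filter Q u) = filter Q u"
    by (simp_all only: Q_def) (rule rev_filter_in_order, auto)+
qed

lemma omega3_crossings: "omega3 a b c K K' \<Longrightarrow> crossings K' = crossings K"
  by (auto elim!: omega3.cases simp: crossings_def)

section \<open>Compatibility with isomorphisms and Reidemeister moves\<close>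

context knot_parity
begin

abbreviation even_part :: "gauss_word \<Rightarrow> gauss_word" where
  "even_part \<equiv> remove_odd is_odd"

text \<open>The same relabelling \<phi> works, since it preserves parities and hence commutes with
  the deletion; only the amount of rotation may change.\<close>

lemma gauss_isomorphic_remove_odd:
  assumes "gauss_isomorphic K K'"
  shows "gauss_isomorphic (even_part K) (even_part K')"
proof -
  obtain \<phi> n where iso: "gauss_iso \<phi> K K'" and inj: "inj_on \<phi> (crossings K)"
    and gd: "gauss_diagram K" "gauss_diagram K'"
    and K': "K' = rotate n (map (map_chord_end \<phi>) K)"
    using assms by (auto simp: gauss_isomorphic_def gauss_iso_def)
  obtain m where m: "even_part K' =
      rotate m (filter (\<lambda>e. \<not> is_odd K' (chord e)) (map (map_chord_end \<phi>) K))"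
    unfolding remove_odd_def using filter_rotate[of _ n "map (map_chord_end \<phi>) K"] K' by metis
  have "chord (map_chord_end \<phi> e) = \<phi> (chord e)" for e
    by (cases e) auto
  then have "filter (\<lambda>e. \<not> is_odd K' (chord e)) (map (map_chord_end \<phi>) K) =
      map (map_chord_end \<phi>) (even_part K)"
    unfolding filter_map remove_odd_def
    using iso_invariant[OF iso]
    by (intro arg_cong[where f = "map _"] filter_cong) (auto simp: crossings_def)
  with m have "even_part K' = rotate m (map (map_chord_end \<phi>) (even_part K))"
    by simp
  moreover have "inj_on \<phi> (crossings (even_part K))"
    using inj by (rule inj_on_subset) (auto simp: crossings_remove_odd)
  ultimately show ?thesis
    using gd gauss_diagram_remove_odd unfolding gauss_isomorphic_def gauss_iso_def by blast
qed

text \<open>The added chord is even and survives, while every other chord has the same fate on both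
  sides.\<close>

lemma omega1_remove_odd:
  assumes "omega1 a K K'"
  shows "omega1 a (even_part K) (even_part K')"
proof -
  have even: "\<not> is_odd K' a"
    by (rule omega1_even[OF assms])
  have K: "filter (\<lambda>e. \<not> is_odd K' (chord e)) K = even_part K"
    unfolding remove_odd_def by (rule filter_even_cong) (rule omega1_others[OF assms])
  have gd: "gauss_diagram (even_part K)" "gauss_diagram (even_part K')"
    using assms by (auto intro: gauss_diagram_remove_odd elim: omega1.cases)
  from assms show ?thesis
  proof cases
    case (over_under s)
    then have "even_part K' = [Over a s, Under a s] @ even_part K"
      using even K by (simp add: remove_odd_def)
    with gd show ?thesis by (metis omega1.over_under)
  next
    case (under_over s)
    then have "even_part K' = [Under a s, Over a s] @ even_part K"
      using even K by (simp add: remove_odd_def)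
    with gd show ?thesis by (metis omega1.under_over)
  qed
qed

lemma omega2_remove_odd:
  assumes "omega2 a b K K'"
  shows "omega2 a b (even_part K) (even_part K') \<or> even_part K' = even_part K"
proof -
  \<comment> \<open>Parities are read off in \<open>K'\<close>, the side on which \<open>a\<close>
    and \<open>b\<close> are present.\<close>
  let ?g = "filter (\<lambda>e. \<not> is_odd K' (chord e))"
  have K: "even_part K = ?g K"
    unfolding remove_odd_def
    by (rule filter_even_cong) (rule omega2_others[OF assms, symmetric])
  have K': "even_part K' = ?g K'"
    by (simp add: remove_odd_def)
  have same: "is_odd K' a = is_odd K' b"
    by (rule omega2_same[OF assms])
  have gd: "gauss_diagram (even_part K)" "gauss_diagram (even_part K')"
    using assms by (auto intro!: gauss_diagram_remove_odd elim: omega2.cases)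
  from assms show ?thesis
  proof cases
    case (parallel xs ys s)
    have fK: "even_part K = ?g xs @ ?g ys"
      using K parallel(1) by simp
    show ?thesis
    \<comment> \<open>If \<open>a\<close> and \<open>b\<close> are odd, all four added letters
      vanish and the word \<open>even_part K\<close> itself remains. If they are even, the same move
      is performed between the filtered words \<open>?g xs\<close> and \<open>?g ys\<close>.\<close>
    proof (cases "is_odd K' a")
      case True
      then have "even_part K' = even_part K"
        using arg_cong[OF parallel(3), of ?g]
        by (simp add: fK K' flip: same)
      then show ?thesis ..
    next
      case False
      then have "even_part K' = [Over a s, Over b (-s)] @ ?g xs @ [Under a s, Under b (-s)] @ ?g ys"
        using arg_cong[OF parallel(3), of ?g]
        by (simp add: K' flip: same)
      then show ?thesis
        using omega2.parallel[OF _ _ gd(2), of "?g xs" "?g ys" a s b] gd(1) fK by simp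
    qed
  next
    case (antiparallel xs ys s)
    have fK: "even_part K = ?g xs @ ?g ys"
      using K antiparallel(1) by simp
    show ?thesis
    proof (cases "is_odd K' a")
      case True
      then have "even_part K' = even_part K"
        using arg_cong[OF antiparallel(3), of ?g]
        by (simp add: fK K' flip: same)
      then show ?thesis ..
    next
      case False
      then have "even_part K' = [Over a s, Over b (-s)] @ ?g xs @ [Under b (-s), Under a s] @ ?g ys"
        using arg_cong[OF antiparallel(3), of ?g]
        by (simp add: K' flip: same)
      then show ?thesis
        using omega2.antiparallel[OF _ _ gd(2), of "?g xs" "?g ys" a s b] gd(1) fK by simp
    qed
  qed
qed

text \<open>A set of even cardinality is not a singleton, so the odd labels among \<open>a\<close>,
  \<open>b\<close>, \<open>c\<close> are either absent or include two of the three.\<close>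

lemma omega3_parities:
  assumes "omega3 a b c K K'"
  shows "\<not> is_odd K a \<and> \<not> is_odd K b \<and> \<not> is_odd K c \<or>
    is_odd K a \<and> is_odd K b \<or> is_odd K a \<and> is_odd K c \<or> is_odd K b \<and> is_odd K c"
proof -
  have single: "{y \<in> {a, b, c}. is_odd K y} \<noteq> {x}" for x
    using omega3_sum[OF assms] by (metis is_singletonI is_singleton_altdef odd_one)
  show ?thesis
    using single[of a] single[of b] single[of c] by auto
qed

lemma omega3_remove_odd:
  assumes "omega3 a b c K K'"
  shows "omega3 a b c (even_part K) (even_part K') \<or> even_part K' = even_part K"
proof -
  let ?g = "filter (\<lambda>e. \<not> is_odd K (chord e))"
  have gd: "gauss_diagram (even_part K)" "gauss_diagram (even_part K')"
    using assms by (auto intro!: gauss_diagram_remove_odd elim: omega3.cases)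
  \<comment> \<open>A crossing of \<open>K'\<close> is a crossing of \<open>K\<close>, participating
    or not, so the two parity axioms for third moves together cover all of them.\<close>
  have K': "even_part K' = ?g K'"
    unfolding remove_odd_def
    using omega3_same[OF assms] omega3_others[OF assms] omega3_crossings[OF assms]
    by (intro filter_even_cong) blast
  have K: "even_part K = ?g K"
    by (simp add: remove_odd_def)
  from omega3_parities[OF assms] show ?thesis
  proof
    assume even: "\<not> is_odd K a \<and> \<not> is_odd K b \<and> \<not> is_odd K c"
    from assms have "omega3 a b c (even_part K) (even_part K')"
    proof cases
      case (top_middle_bottom t m u xs ys zs)
      note strands = omega3_strands_filter_even[OF top_middle_bottom(1), of "\<lambda>c. \<not> is_odd K c"]
      have "even_part K = t @ ?g xs @ m @ ?g ys @ u @ ?g zs"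
        using even arg_cong[OF top_middle_bottom(2), of ?g] by (simp add: K strands)
      moreover have "even_part K' = rev t @ ?g xs @ rev m @ ?g ys @ rev u @ ?g zs"
        using even arg_cong[OF top_middle_bottom(3), of ?g]
        by (simp add: K' strands flip: rev_filter)
      ultimately show ?thesis
        using omega3.top_middle_bottom[OF top_middle_bottom(1)] gd by blast
    next
      case (top_bottom_middle t m u xs ys zs)
      note strands = omega3_strands_filter_even[OF top_bottom_middle(1), of "\<lambda>c. \<not> is_odd K c"]
      have "even_part K = t @ ?g xs @ u @ ?g ys @ m @ ?g zs"
        using even arg_cong[OF top_bottom_middle(2), of ?g] by (simp add: K strands)
      moreover have "even_part K' = rev t @ ?g xs @ rev u @ ?g ys @ rev m @ ?g zs"
        using even arg_cong[OF top_bottom_middle(3), of ?g]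
        by (simp add: K' strands flip: rev_filter)
      ultimately show ?thesis
        using omega3.top_bottom_middle[OF top_bottom_middle(1)] gd by blast
    qed
    then show ?thesis ..
  next
    assume odd: "is_odd K a \<and> is_odd K b \<or> is_odd K a \<and> is_odd K c \<or> is_odd K b \<and> is_odd K c"
    from assms have "even_part K' = even_part K"
    proof cases
      case (top_middle_bottom t m u xs ys zs)
      \<comment> \<open>Each filtered strand is its own reversal, so the reversals in
        \<open>K'\<close> disappear.\<close>
      have "?g K' = ?g t @ ?g xs @ ?g m @ ?g ys @ ?g u @ ?g zs"
        using omega3_strands_rev_filter[OF top_middle_bottom(1), of "\<lambda>c. \<not> is_odd K c"] odd
          arg_cong[OF top_middle_bottom(3), of ?g]
        by (simp flip: rev_filter)
      also have "\<dots> = ?g K"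
        using arg_cong[OF top_middle_bottom(2), of ?g] by simp
      finally show ?thesis
        by (simp add: K K')
    next
      case (top_bottom_middle t m u xs ys zs)
      have "?g K' = ?g t @ ?g xs @ ?g u @ ?g ys @ ?g m @ ?g zs"
        using omega3_strands_rev_filter[OF top_bottom_middle(1), of "\<lambda>c. \<not> is_odd K c"] odd
          arg_cong[OF top_bottom_middle(3), of ?g]
        by (simp flip: rev_filter)
      also have "\<dots> = ?g K"
        using arg_cong[OF top_bottom_middle(2), of ?g] by simp
      finally show ?thesis
        by (simp add: K K')
    qed
    then show ?thesis ..
  qed
qed

lemma elementary_move_remove_odd:
  assumes "elementary_move K K'"
  shows "elementary_move (even_part K) (even_part K')"
proof -
  \<comment> \<open>Needed when a second or third move collapses to an equality of words, which is
    an elementary move by way of the identity isomorphism.\<close>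
  have "gauss_isomorphic (even_part K) (even_part K)"
    using assms by (intro gauss_isomorphic_refl gauss_diagram_remove_odd)
      (rule elementary_move_gauss_diagram)
  then show ?thesis
    using assms gauss_isomorphic_remove_odd omega1_remove_odd omega2_remove_odd omega3_remove_odd
    unfolding elementary_move_def by metis
qed

text \<open>Induction along a chain of moves: each link, traversed in either direction, is sent to a
  link traversed in the same direction.\<close>

lemma same_virtual_knot_remove_odd:
  assumes "same_virtual_knot K K'"
  shows "same_virtual_knot (even_part K) (even_part K')"
proof -
  have "equivclp elementary_move K K'"
    using assms by (simp add: same_virtual_knot_def)
  then have "equivclp elementary_move (even_part K) (even_part K')"
  proof (induction rule: equivclp_induct)
    case base
    show ?case by simp
  next
    case (step L L')
    then show ?case
      by (meson elementary_move_remove_odd equivclp_into_equivclp)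
  qed
  with assms show ?thesis
    by (simp add: same_virtual_knot_def gauss_diagram_remove_odd)
qed

end

section \<open>Passage to virtual knots\<close>

lemma same_virtual_knot_refl_iff: "same_virtual_knot K K \<longleftrightarrow> gauss_diagram K"
  by (auto simp: same_virtual_knot_def)

text \<open>Existence comes from applying \<open>g\<close> to a chosen representative, uniqueness
  from every virtual knot being the class of some Gauss diagram.\<close>

lemma virtual_knot_map_unique:
  assumes "\<And>K K'. same_virtual_knot K K' \<Longrightarrow> same_virtual_knot (g K) (g K')"
  shows "\<exists>!F. \<forall>K. gauss_diagram K \<longrightarrow> F (virtual_knot_of K) = virtual_knot_of (g K)"
proof (rule ex1I)
  let ?F = "\<lambda>v. virtual_knot_of (g (rep_virtual_knot v))"
  show "\<forall>K. gauss_diagram K \<longrightarrow> ?F (virtual_knot_of K) = virtual_knot_of (g K)"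
  proof (intro allI impI)
    fix K assume "gauss_diagram K"
    \<comment> \<open>The chosen representative may differ from \<open>K\<close>, but it is
      equivalent to \<open>K\<close>, and \<open>g\<close> respects equivalence.\<close>
    then have "same_virtual_knot (rep_virtual_knot (virtual_knot_of K)) K"
      using rep_abs_rsp_left[OF Quotient3_virtual_knot] by (simp add: same_virtual_knot_refl_iff)
    then show "?F (virtual_knot_of K) = virtual_knot_of (g K)"
      using Quotient3_rel_abs[OF Quotient3_virtual_knot] assms by blast
  qed
  fix F assume F: "\<forall>K. gauss_diagram K \<longrightarrow> F (virtual_knot_of K) = virtual_knot_of (g K)"
  show "F = ?F"
  proof
    fix v
    \<comment> \<open>Representatives lie in the domain of the partial equivalence, which consists
      of the Gauss diagrams; so the condition on \<open>F\<close> determines its value at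
      \<open>v\<close>.\<close>
    have "gauss_diagram (rep_virtual_knot v)"
      using Quotient3_rep_reflp[OF Quotient3_virtual_knot] by (simp flip: same_virtual_knot_refl_iff)
    with F show "F v = ?F v"
      using Quotient3_abs_rep[OF Quotient3_virtual_knot] by metis
  qed
qed

theorem theorem1:
  fixes is_odd :: "gauss_word \<Rightarrow> nat \<Rightarrow> bool"
  assumes "knot_parity is_odd"
  defines "f \<equiv> remove_odd is_odd"
  shows
    "(\<forall>K. gauss_diagram K \<longrightarrow> gauss_diagram (f K)) \<and>
     (\<forall>K K'. same_virtual_knot K K' \<longrightarrow> same_virtual_knot (f K) (f K')) \<and>
     (\<exists>!F :: virtual_knot \<Rightarrow> virtual_knot.
        \<forall>K. gauss_diagram K \<longrightarrow> F (virtual_knot_of K) = virtual_knot_of (f K)) \<and>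
     (\<forall>K. gauss_diagram K \<longrightarrow>
        (gauss_isomorphic (f K) K \<longleftrightarrow> (\<forall>c \<in> crossings K. \<not> is_odd K c)) \<and>
        (\<not> gauss_isomorphic (f K) K \<longrightarrow> card (crossings (f K)) < card (crossings K)))"
proof -
  interpret knot_parity is_odd by fact
  show ?thesis
    unfolding f_def
  proof (intro conjI allI impI)
    show "gauss_diagram (remove_odd is_odd K)" if "gauss_diagram K" for K
      using that by (rule gauss_diagram_remove_odd)
    show "same_virtual_knot (remove_odd is_odd K) (remove_odd is_odd K')"
      if "same_virtual_knot K K'" for K K'
      using that by (rule same_virtual_knot_remove_odd)
    show "\<exists>!F. \<forall>K. gauss_diagram K \<longrightarrow>
        F (virtual_knot_of K) = virtual_knot_of (remove_odd is_odd K)"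
      by (rule virtual_knot_map_unique) (rule same_virtual_knot_remove_odd)
    fix K assume K: "gauss_diagram K"
    show iff: "gauss_isomorphic (remove_odd is_odd K) K \<longleftrightarrow> (\<forall>c \<in> crossings K. \<not> is_odd K c)"
      using K by (rule gauss_isomorphic_remove_odd_iff)
    show "card (crossings (remove_odd is_odd K)) < card (crossings K)"
      if "\<not> gauss_isomorphic (remove_odd is_odd K) K"
      \<comment> \<open>By \<open>iff\<close>, failure of the isomorphism supplies an odd crossing,
        and its removal makes the count drop.\<close>
      using that card_crossings_remove_odd_less unfolding iff by blast
  qed
qed

end
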